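(* Suppose $X\subseteq\mathbb R^n$ is definable (with parameters) in an o-minimal expansion of the real field. Then $X^{alg}=X^{alg}_t$.
   Context: For $X\subseteq\mathbb R^n$, the algebraic part $X^{alg}$ is the union of all infinite connected semialgebraic subsets of $X$. The algebraic trace part of $X$ is $$X^{alg}_t=\bigcup\{X\cap T:\ T\subseteq\mathbb R^n \text{ infinite connected semialgebraic, and } T\subseteq cl(X\cap T)\},$$ where $cl$ denotes topological closure in $\mathbb R^n$. Semialgebraic means definable with real parameters in the real field. *)

theory Defs
  imports "HOL-Analysis.Analysis"
begin

section \<open>First-order structures on the reals and definable sets\<close>

text \<open>
  A first-order structure with universe the real numbers is given by its basic operations and
  relations, each paired with its arity; there is no restriction on how many there are. A nonlogical
  symbol is identified with its interpretation, so two symbols with the same arity and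
  interpretation are not distinguished; this does not affect definability. Arguments are passed as
  lists, and only the values on lists whose length is the arity matter.
\<close>

record real_structure =
  opers :: "(nat \<times> (real list \<Rightarrow> real)) set"
  rels :: "(nat \<times> (real list \<Rightarrow> bool)) set"

datatype trm =
    Var nat
  | Param real
  | App "real list \<Rightarrow> real" "trm list"

datatype fml =
    Eq trm trm
  | Rel "real list \<Rightarrow> bool" "trm list"
  | Neg fml
  | Conj fml fml
  | Exi nat fml

primrec trm_over :: "real_structure \<Rightarrow> trm \<Rightarrow> bool" where
  "trm_over M (Var i) = True"
| "trm_over M (Param a) = True"
| "trm_over M (App f ts) = ((length ts, f) \<in> opers M \<and> list_all (trm_over M) ts)"

primrec fml_over :: "real_structure \<Rightarrow> fml \<Rightarrow> bool" where
  "fml_over M (Eq s t) = (trm_over M s \<and> trm_over M t)"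
| "fml_over M (Rel r ts) = ((length ts, r) \<in> rels M \<and> list_all (trm_over M) ts)"
| "fml_over M (Neg p) = fml_over M p"
| "fml_over M (Conj p q) = (fml_over M p \<and> fml_over M q)"
| "fml_over M (Exi i p) = fml_over M p"

primrec trm_vars :: "trm \<Rightarrow> nat set" where
  "trm_vars (Var i) = {i}"
| "trm_vars (Param a) = {}"
| "trm_vars (App f ts) = \<Union> (set (map trm_vars ts))"

primrec free_vars :: "fml \<Rightarrow> nat set" where
  "free_vars (Eq s t) = trm_vars s \<union> trm_vars t"
| "free_vars (Rel r ts) = \<Union> (set (map trm_vars ts))"
| "free_vars (Neg p) = free_vars p"
| "free_vars (Conj p q) = free_vars p \<union> free_vars q"
| "free_vars (Exi i p) = free_vars p - {i}"

primrec trm_val :: "(nat \<Rightarrow> real) \<Rightarrow> trm \<Rightarrow> real" where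
  "trm_val x (Var i) = x i"
| "trm_val x (Param a) = a"
| "trm_val x (App f ts) = f (map (trm_val x) ts)"

primrec holds :: "(nat \<Rightarrow> real) \<Rightarrow> fml \<Rightarrow> bool" where
  "holds x (Eq s t) = (trm_val x s = trm_val x t)"
| "holds x (Rel r ts) = r (map (trm_val x) ts)"
| "holds x (Neg p) = (\<not> holds x p)"
| "holds x (Conj p q) = (holds x p \<and> holds x q)"
| "holds x (Exi i p) = (\<exists>a. holds (x(i := a)) p)"

text \<open>
  Real \<open>n\<close>-space is the library's \<open>Euclidean_space n\<close>: points are the functions
  \<open>x :: nat \<Rightarrow> real\<close> with \<open>x i = 0\<close> for all \<open>i \<ge> n\<close>, so that the coordinates are
  \<open>x 0, \<dots>, x (n - 1)\<close>. Definability is with real parameters.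
\<close>

definition definable :: "real_structure \<Rightarrow> nat \<Rightarrow> (nat \<Rightarrow> real) set \<Rightarrow> bool" where
  "definable M n X \<longleftrightarrow>
     (\<exists>p. fml_over M p \<and> free_vars p \<subseteq> {..<n} \<and>
          X = {x \<in> topspace (Euclidean_space n). holds x p})"

definition real_field :: real_structure where
  "real_field =
     \<lparr>opers = {(0, \<lambda>_. 0), (0, \<lambda>_. 1), (1, \<lambda>as. - as ! 0),
               (2, \<lambda>as. as ! 0 + as ! 1), (2, \<lambda>as. as ! 0 * as ! 1)},
      rels = {}\<rparr>"

definition expansion_of :: "real_structure \<Rightarrow> real_structure \<Rightarrow> bool" where
  "expansion_of M N \<longleftrightarrow> opers N \<subseteq> opers M \<and> rels N \<subseteq> rels M"

definition point_or_open_interval :: "real set \<Rightarrow> bool" where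
  "point_or_open_interval I \<longleftrightarrow>
     (\<exists>a. I = {a}) \<or> (\<exists>a b. I = {a<..<b}) \<or> (\<exists>a. I = {a<..}) \<or> (\<exists>b. I = {..<b}) \<or> I = UNIV"

definition o_minimal :: "real_structure \<Rightarrow> bool" where
  "o_minimal M \<longleftrightarrow>
     (\<forall>X. definable M 1 X \<longrightarrow>
        (\<exists>\<I>. finite \<I> \<and> (\<forall>I\<in>\<I>. point_or_open_interval I) \<and> (\<lambda>x. x 0) ` X = \<Union> \<I>))"

definition semialgebraic :: "nat \<Rightarrow> (nat \<Rightarrow> real) set \<Rightarrow> bool" where
  "semialgebraic n X \<longleftrightarrow> definable real_field n X"

section \<open>The algebraic part and the algebraic trace part\<close>

definition algebraic_part :: "nat \<Rightarrow> (nat \<Rightarrow> real) set \<Rightarrow> (nat \<Rightarrow> real) set" where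
  "algebraic_part n X =
     \<Union> {S. S \<subseteq> X \<and> infinite S \<and> connectedin (Euclidean_space n) S \<and> semialgebraic n S}"

definition algebraic_trace_part :: "nat \<Rightarrow> (nat \<Rightarrow> real) set \<Rightarrow> (nat \<Rightarrow> real) set" where
  "algebraic_trace_part n X =
     \<Union> {X \<inter> T | T. infinite T \<and> connectedin (Euclidean_space n) T \<and> semialgebraic n T \<and>
                   T \<subseteq> Euclidean_space n closure_of (X \<inter> T)}"

end

theory Submission
  imports Defs
begin

text \<open>
  One inclusion is immediate: a set \<open>S\<close> witnessing membership in the algebraic part is its own trace on
  \<open>X\<close>. For the other, let \<open>x\<close> lie in \<open>X \<inter> T\<close>, where \<open>T\<close> is infinite, connected and semialgebraic and
  \<open>X \<inter> T\<close> is dense in \<open>T\<close>. It suffices to find a semialgebraic curve \<open>c\<close> on an interval \<open>(0, \<epsilon>)\<close> with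
  \<open>c(\<rho>) \<in> X\<close> and \<open>0 < |c(\<rho>) - x| < \<rho>\<close>; then \<open>{x} \<union> c(0, \<epsilon>)\<close> is the desired set
  (\<open>semialgebraic_arc\<close>).

  The curve is chosen coordinate by coordinate. Let \<open>T\<^sub>\<rho>\<close> be the set of points of \<open>T\<close> other than \<open>x\<close> at
  distance less than \<open>\<rho>\<close> from \<open>x\<close>. It is nonempty because an infinite connected set has no isolated
  points, and \<open>X \<inter> T\<^sub>\<rho>\<close> is dense in it. When the first coordinates have been fixed, the values possible
  for the next one form a nonempty bounded set \<open>S\<close> of reals, a finite union of points and intervals. If
  its infimum is isolated in \<open>S\<close>, that point is taken; otherwise \<open>S\<close> contains a maximal interval
  \<open>(a, b)\<close> beginning at the infimum \<open>a\<close>, and \<open>a + s (b - a)\<close> is taken, with a parameter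
  \<open>s \<in> (0, 1)\<close>. Density of \<open>X\<close> in \<open>T\<^sub>\<rho>\<close> is inherited by the fibre over an isolated value, and
  also by the fibre over every value that avoids the frontiers of the projections of \<open>X \<inter> T\<^sub>\<rho>\<close> cut with
  rational boxes (\<open>dense_over_insert\<close>). By o-minimality these frontiers are countable. Hence, for
  countably many radii \<open>r 0, r 1, \<dots>\<close> at once, all but countably many \<open>s\<close> are good. Once all
  coordinates are fixed, the fibre is a single point in which \<open>X\<close> is dense, so the point is in \<open>X\<close>
  (\<open>definable_generic_curve\<close>).

  The resulting curve \<open>c\<close> is definable in the real field, since the choice is by an explicit formula with
  real parameters, and \<open>c(r k) \<in> X\<close> for a sequence \<open>r k\<close> tending to \<open>0\<close>. The set of all \<open>\<rho>\<close> with
  \<open>c(\<rho>) \<in> X\<close> is definable in the given o-minimal structure, so it contains an interval \<open>(0, \<epsilon>)\<close>. In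
  the same way the coordinates of \<open>c\<close> are continuous on such an interval
  (\<open>o_minimal_eventually_isCont\<close>); the real field is o-minimal because every set definable in it is
  definable in the expansion.
\<close>

section \<open>Definable predicates\<close>

lemma trm_val_cong:
  "(\<And>i. i \<in> trm_vars t \<Longrightarrow> x i = y i) \<Longrightarrow> trm_val x t = trm_val y t"
proof (induction t)
  case (App f ts)
  then have "map (trm_val x) ts = map (trm_val y) ts" by auto
  then show ?case by (simp only: trm_val.simps)
qed auto

lemma holds_cong:
  "(\<And>i. i \<in> free_vars p \<Longrightarrow> x i = y i) \<Longrightarrow> holds x p = holds y p"
proof (induction p arbitrary: x y)
  case (Eq s t)
  have "trm_val x s = trm_val y s" "trm_val x t = trm_val y t"
    using Eq by (auto intro!: trm_val_cong)
  then show ?case by simp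
next
  case (Rel r ts)
  then have "map (trm_val x) ts = map (trm_val y) ts" by (auto intro!: trm_val_cong)
  then show ?case by (simp only: holds.simps)
next
  case (Exi i p)
  have "holds (x(i := a)) p = holds (y(i := a)) p" for a
    by (rule Exi.IH) (use Exi.prems in auto)
  then show ?case by simp
next
  case (Conj p q)
  have "holds x p = holds y p" "holds x q = holds y q"
    using Conj.prems by (auto intro!: Conj.IH)
  then show ?case by simp
next
  case (Neg p)
  have "holds x p = holds y p"
    using Neg.prems by (auto intro!: Neg.IH)
  then show ?case by simp
qed

lemma finite_trm_vars: "finite (trm_vars t)"
  by (induction t) auto

lemma finite_free_vars: "finite (free_vars p)"
  by (induction p) (auto simp: finite_trm_vars)

primrec trm_subst :: "(nat \<Rightarrow> trm) \<Rightarrow> trm \<Rightarrow> trm" where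
  "trm_subst \<sigma> (Var i) = \<sigma> i"
| "trm_subst \<sigma> (Param a) = Param a"
| "trm_subst \<sigma> (App f ts) = App f (map (trm_subst \<sigma>) ts)"

lemma trm_val_subst: "trm_val x (trm_subst \<sigma> t) = trm_val (\<lambda>j. trm_val x (\<sigma> j)) t"
proof (induction t)
  case (App f ts)
  then have "map (trm_val x) (map (trm_subst \<sigma>) ts) = map (trm_val (\<lambda>j. trm_val x (\<sigma> j))) ts"
    by auto
  then show ?case by (simp only: trm_val.simps trm_subst.simps)
qed auto

lemma trm_over_subst: "trm_over M t \<Longrightarrow> (\<And>j. trm_over M (\<sigma> j)) \<Longrightarrow> trm_over M (trm_subst \<sigma> t)"
  by (induction t) (auto simp: list_all_iff)

lemma trm_vars_subst: "trm_vars (trm_subst \<sigma> t) = (\<Union>j\<in>trm_vars t. trm_vars (\<sigma> j))"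
  by (induction t) auto

text \<open>
  Simultaneous substitution of terms is only needed up to equivalence, so the bound variable of a
  quantifier may be renamed to any variable that does not occur in the substituted terms.
\<close>

lemma fml_subst:
  assumes "fml_over M p" and "\<And>j. trm_over M (\<sigma> j)"
  shows "\<exists>q. fml_over M q \<and> free_vars q \<subseteq> (\<Union>j\<in>free_vars p. trm_vars (\<sigma> j)) \<and>
             (\<forall>x. holds x q = holds (\<lambda>j. trm_val x (\<sigma> j)) p)"
  using assms
proof (induction p arbitrary: \<sigma>)
  case (Eq s t)
  then show ?case
    by (intro exI[of _ "Eq (trm_subst \<sigma> s) (trm_subst \<sigma> t)"])
      (simp add: trm_over_subst trm_vars_subst trm_val_subst)
next
  case (Rel r ts)
  have "map (trm_val x) (map (trm_subst \<sigma>) ts) = map (trm_val (\<lambda>j. trm_val x (\<sigma> j))) ts" for x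
    by (simp add: trm_val_subst)
  then have "holds x (Rel r (map (trm_subst \<sigma>) ts)) = holds (\<lambda>j. trm_val x (\<sigma> j)) (Rel r ts)" for x
    by (simp only: holds.simps)
  moreover have "fml_over M (Rel r (map (trm_subst \<sigma>) ts))"
    using Rel by (auto simp: list_all_iff trm_over_subst)
  moreover have "free_vars (Rel r (map (trm_subst \<sigma>) ts)) \<subseteq> (\<Union>j\<in>free_vars (Rel r ts). trm_vars (\<sigma> j))"
    by (auto simp: trm_vars_subst)
  ultimately show ?case by blast
next
  case (Neg p)
  then obtain q where "fml_over M q" "free_vars q \<subseteq> (\<Union>j\<in>free_vars p. trm_vars (\<sigma> j))"
    "\<forall>x. holds x q = holds (\<lambda>j. trm_val x (\<sigma> j)) p" by (metis fml_over.simps(3))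
  then show ?case by (intro exI[of _ "Neg q"]) simp
next
  case (Conj p p')
  then have pp: "fml_over M p" "fml_over M p'" by simp_all
  obtain q where "fml_over M q" "free_vars q \<subseteq> (\<Union>j\<in>free_vars p. trm_vars (\<sigma> j))"
    "\<forall>x. holds x q = holds (\<lambda>j. trm_val x (\<sigma> j)) p"
    using Conj.IH(1)[where \<sigma> = \<sigma>, OF pp(1) Conj.prems(2)] by blast
  moreover obtain q' where "fml_over M q'" "free_vars q' \<subseteq> (\<Union>j\<in>free_vars p'. trm_vars (\<sigma> j))"
    "\<forall>x. holds x q' = holds (\<lambda>j. trm_val x (\<sigma> j)) p'"
    using Conj.IH(2)[where \<sigma> = \<sigma>, OF pp(2) Conj.prems(2)] by blast
  ultimately show ?case by (intro exI[of _ "Conj q q'"]) auto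
next
  case (Exi i p)
  define V where "V = (\<Union>j\<in>free_vars p. trm_vars (\<sigma> j))"
  have "finite V"
    unfolding V_def by (auto simp: finite_free_vars finite_trm_vars)
  then obtain k where k: "k \<notin> V"
    using ex_new_if_finite infinite_UNIV_nat by blast
  let ?\<tau> = "\<sigma>(i := Var k)"
  have "fml_over M p" "\<And>j. trm_over M (?\<tau> j)" using Exi.prems by auto
  from Exi.IH[where \<sigma> = ?\<tau>, OF this] obtain q where q: "fml_over M q"
    "free_vars q \<subseteq> (\<Union>j\<in>free_vars p. trm_vars (?\<tau> j))"
    "\<And>x. holds x q = holds (\<lambda>j. trm_val x (?\<tau> j)) p" by blast
  have "holds (x(k := a)) q = holds ((\<lambda>j. trm_val x (\<sigma> j))(i := a)) p" for x a
    unfolding q(3)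
  proof (rule holds_cong)
    fix j assume j: "j \<in> free_vars p"
    show "trm_val (x(k := a)) (?\<tau> j) = ((\<lambda>j. trm_val x (\<sigma> j))(i := a)) j"
    proof (cases "j = i")
      case False
      then have "trm_val (x(k := a)) (\<sigma> j) = trm_val x (\<sigma> j)"
        using k j by (intro trm_val_cong) (auto simp: V_def)
      then show ?thesis using False by simp
    qed simp
  qed
  moreover have "free_vars (Exi k q) \<subseteq> (\<Union>j\<in>free_vars (Exi i p). trm_vars (\<sigma> j))"
    using q(2) by (fastforce split: if_splits)
  ultimately show ?case
    using q(1) by (intro exI[of _ "Exi k q"]) simp
qed

text \<open>
  A semantic notion, for predicates of an infinite sequence of reals: composite predicates are then
  recognised as definable by their shape alone.
\<close>

definition definable_pred :: "real_structure \<Rightarrow> ((nat \<Rightarrow> real) \<Rightarrow> bool) \<Rightarrow> bool" where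
  "definable_pred M P \<longleftrightarrow> (\<exists>p. fml_over M p \<and> (\<forall>x. holds x p = P x))"

definition term_fun :: "real_structure \<Rightarrow> ((nat \<Rightarrow> real) \<Rightarrow> real) \<Rightarrow> bool" where
  "term_fun M f \<longleftrightarrow> (\<exists>t. trm_over M t \<and> (\<forall>x. trm_val x t = f x))"

lemma term_fun_var: "term_fun M (\<lambda>x. x i)"
  unfolding term_fun_def by (rule exI[of _ "Var i"]) simp

lemma term_fun_const: "term_fun M (\<lambda>x. c)"
  unfolding term_fun_def by (rule exI[of _ "Param c"]) simp

lemma term_fun_if:
  "(b \<Longrightarrow> term_fun M f) \<Longrightarrow> (\<not> b \<Longrightarrow> term_fun M g) \<Longrightarrow> term_fun M (\<lambda>x. if b then f x else g x)"
  by (cases b) auto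

lemma term_fun_add:
  assumes "expansion_of M real_field" "term_fun M f" "term_fun M g"
  shows "term_fun M (\<lambda>x. f x + g x)"
proof -
  obtain s t where "trm_over M s" "trm_over M t" "\<forall>x. trm_val x s = f x" "\<forall>x. trm_val x t = g x"
    using assms(2,3) by (auto simp: term_fun_def)
  moreover have "(Suc (Suc 0), \<lambda>as. as ! 0 + as ! 1) \<in> opers M"
    using assms(1) by (auto simp: expansion_of_def real_field_def numeral_2_eq_2)
  ultimately show ?thesis
    unfolding term_fun_def by (intro exI[of _ "App (\<lambda>as. as ! 0 + as ! 1) [s, t]"]) simp
qed

lemma term_fun_mult:
  assumes "expansion_of M real_field" "term_fun M f" "term_fun M g"
  shows "term_fun M (\<lambda>x. f x * g x)"
proof -
  obtain s t where "trm_over M s" "trm_over M t" "\<forall>x. trm_val x s = f x" "\<forall>x. trm_val x t = g x"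
    using assms(2,3) by (auto simp: term_fun_def)
  moreover have "(Suc (Suc 0), \<lambda>as. as ! 0 * as ! 1) \<in> opers M"
    using assms(1) by (auto simp: expansion_of_def real_field_def numeral_2_eq_2)
  ultimately show ?thesis
    unfolding term_fun_def by (intro exI[of _ "App (\<lambda>as. as ! 0 * as ! 1) [s, t]"]) simp
qed

lemma term_fun_diff:
  assumes "expansion_of M real_field" "term_fun M f" "term_fun M g"
  shows "term_fun M (\<lambda>x. f x - g x)"
proof -
  have "term_fun M (\<lambda>x. f x + (-1) * g x)"
    by (intro term_fun_add term_fun_mult term_fun_const assms)
  then show ?thesis by simp
qed

lemma definable_pred_subst:
  assumes "definable_pred M P" "\<And>i. term_fun M (\<lambda>x. f x i)"
  shows "definable_pred M (\<lambda>x. P (f x))"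
proof -
  obtain p where p: "fml_over M p" "\<And>x. holds x p = P x"
    using assms(1) by (auto simp: definable_pred_def)
  obtain \<sigma> where \<sigma>: "\<And>i. trm_over M (\<sigma> i)" "\<And>i x. trm_val x (\<sigma> i) = f x i"
    using assms(2) unfolding term_fun_def by metis
  show ?thesis
    using fml_subst[where \<sigma> = \<sigma>, OF p(1) \<sigma>(1)] unfolding definable_pred_def by (auto simp: \<sigma>(2) p(2))
qed

lemma definable_pred_eq:
  "term_fun M f \<Longrightarrow> term_fun M g \<Longrightarrow> definable_pred M (\<lambda>x. f x = g x)"
  unfolding term_fun_def definable_pred_def by (metis fml_over.simps(1) holds.simps(1))

lemma definable_pred_not: "definable_pred M P \<Longrightarrow> definable_pred M (\<lambda>x. \<not> P x)"
  unfolding definable_pred_def by (metis fml_over.simps(3) holds.simps(3))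

lemma definable_pred_conj:
  "definable_pred M P \<Longrightarrow> definable_pred M Q \<Longrightarrow> definable_pred M (\<lambda>x. P x \<and> Q x)"
  unfolding definable_pred_def by (metis fml_over.simps(4) holds.simps(4))

lemma definable_pred_disj:
  assumes "definable_pred M P" "definable_pred M Q" 
  shows "definable_pred M (\<lambda>x. P x \<or> Q x)"
  using definable_pred_not[OF definable_pred_conj[OF assms[THEN definable_pred_not]]] by simp

lemma definable_pred_imp:
  assumes "definable_pred M P" "definable_pred M Q" 
  shows "definable_pred M (\<lambda>x. P x \<longrightarrow> Q x)"
  using definable_pred_disj[OF definable_pred_not[OF assms(1)] assms(2)] by (simp only: imp_conv_disj)

lemma definable_pred_const: "definable_pred M (\<lambda>x. b)"
proof (cases b)
  case True
  then show ?thesis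
    using definable_pred_eq[OF term_fun_const[of _ 0] term_fun_const[of _ 0], of M] by simp
next
  case False
  then show ?thesis
    using definable_pred_eq[OF term_fun_const[of _ 0] term_fun_const[of _ 1], of M] by simp
qed

lemma definable_pred_ex_coord:
  "definable_pred M P \<Longrightarrow> definable_pred M (\<lambda>x. \<exists>a. P (x(i := a)))"
  unfolding definable_pred_def by (metis fml_over.simps(5) holds.simps(5))

text \<open>
  In de Bruijn style the bound variable is coordinate \<open>0\<close> of the new environment and the old
  coordinates move up by one, so that no fresh variable has to be chosen and the rule can be applied
  by unification.
\<close>

lemma definable_pred_ex:
  assumes "definable_pred M (\<lambda>y. Q (y 0) (\<lambda>i. y (Suc i)))"
  shows "definable_pred M (\<lambda>x. \<exists>a. Q a x)"
proof -
  have "definable_pred M (\<lambda>y. \<exists>a. Q a (\<lambda>i. y (Suc i)))"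
    using definable_pred_ex_coord[OF assms, of 0] by simp
  from definable_pred_subst[OF this term_fun_var, of "\<lambda>i. i - 1"] show ?thesis by simp
qed

lemma definable_pred_all:
  assumes "definable_pred M (\<lambda>y. Q (y 0) (\<lambda>i. y (Suc i)))"
  shows "definable_pred M (\<lambda>x. \<forall>a. Q a x)"
  using definable_pred_not[OF definable_pred_ex[of M "\<lambda>a x. \<not> Q a x", OF definable_pred_not[OF assms]]]
  by simp

text \<open>
  The order is definable in the field: positive reals are the squares of nonzero reals.
\<close>

lemma definable_pred_less:
  assumes "expansion_of M real_field" "term_fun M f" "term_fun M g"
  shows "definable_pred M (\<lambda>x. f x < g x)"
proof -
  have "f x < g x \<longleftrightarrow> (\<exists>c. \<not> c = 0 \<and> f x + c * c = g x)" for x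
  proof
    assume "f x < g x"
    then show "\<exists>c. \<not> c = 0 \<and> f x + c * c = g x"
      by (intro exI[of _ "sqrt (g x - f x)"]) simp
  next
    assume "\<exists>c. \<not> c = 0 \<and> f x + c * c = g x"
    then obtain c where "c \<noteq> 0" "f x + c * c = g x" by blast
    moreover from this have "c * c > 0" by (metis not_square_less_zero linorder_neqE_linordered_idom mult_eq_0_iff)
    ultimately show "f x < g x" by linarith
  qed
  moreover have "definable_pred M (\<lambda>x. \<exists>c. \<not> c = 0 \<and> x 0 + c * c = x (Suc 0))"
    by (intro definable_pred_ex definable_pred_conj definable_pred_not definable_pred_eq
        term_fun_add term_fun_mult term_fun_var term_fun_const assms(1))
  from definable_pred_subst[OF this, of "\<lambda>x i. if i = 0 then f x else g x"]
  have "definable_pred M (\<lambda>x. \<exists>c. \<not> c = 0 \<and> f x + c * c = g x)"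
    by (simp add: assms term_fun_if)
  ultimately show ?thesis by simp
qed

lemma definable_pred_le:
  assumes "expansion_of M real_field" "term_fun M f" "term_fun M g"
  shows "definable_pred M (\<lambda>x. f x \<le> g x)"
  using definable_pred_not[OF definable_pred_less[OF assms(1,3,2)]] by (simp add: not_less)

lemma definable_pred_ball_less:
  assumes "\<And>i. i < (n::nat) \<Longrightarrow> definable_pred M (P i)"
  shows "definable_pred M (\<lambda>x. \<forall>i<n. P i x)"
  using assms
proof (induction n)
  case (Suc n)
  have "definable_pred M (\<lambda>x. (\<forall>i<n. P i x) \<and> P n x)"
    using Suc by (intro definable_pred_conj) auto
  then show ?case by (simp add: All_less_Suc conj_commute)
qed (simp add: definable_pred_const)

lemma definable_pred_bex_less:
  assumes "\<And>i. i < (n::nat) \<Longrightarrow> definable_pred M (P i)"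
  shows "definable_pred M (\<lambda>x. \<exists>i<n. P i x)"
  using definable_pred_not[OF definable_pred_ball_less[OF definable_pred_not[OF assms]]] by simp

lemmas definable_intros =
  definable_pred_conj definable_pred_disj definable_pred_imp definable_pred_not
  definable_pred_ex definable_pred_all definable_pred_eq definable_pred_less definable_pred_le
  definable_pred_ball_less definable_pred_bex_less
  term_fun_add term_fun_mult term_fun_diff term_fun_if term_fun_var term_fun_const

text \<open>
  A formula mentions finitely many variables, so quantification over whole sequences, with any set
  of coordinates prescribed, amounts to finitely many quantifiers over reals.
\<close>

lemma definable_pred_project:
  assumes "definable_pred M P"
  shows "definable_pred M (\<lambda>x. \<exists>z. (\<forall>i\<in>K. z i = x i) \<and> P z)"
proof -
  obtain p where p: "fml_over M p" "\<And>x. holds x p = P x"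
    using assms by (auto simp: definable_pred_def)
  have *: "definable_pred M (\<lambda>x. \<exists>z. (\<forall>i. i \<notin> F \<longrightarrow> z i = x i) \<and> P z)" if "finite F" for F
    using that
  proof (induction F)
    case empty
    have "(\<forall>i. z i = x i) \<longleftrightarrow> z = x" for z x :: "nat \<Rightarrow> real" by auto
    then show ?case using assms by simp
  next
    case (insert k F)
    have "(\<exists>z. (\<forall>i. i \<notin> insert k F \<longrightarrow> z i = x i) \<and> P z) \<longleftrightarrow>
          (\<exists>a z. (\<forall>i. i \<notin> F \<longrightarrow> z i = (x(k := a)) i) \<and> P z)" (is "?L \<longleftrightarrow> ?R") for x
    proof
      assume ?L
      then obtain z where "\<forall>i. i \<notin> insert k F \<longrightarrow> z i = x i" "P z" by blast
      then show ?R by (intro exI[of _ "z k"] exI[of _ z]) auto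
    next
      assume ?R
      then show ?L by (metis fun_upd_other insert_iff)
    qed
    then show ?case using definable_pred_ex_coord[OF insert.IH, of k] by simp
  qed
  have "(\<exists>z. (\<forall>i\<in>K. z i = x i) \<and> P z) \<longleftrightarrow>
        (\<exists>z. (\<forall>i. i \<notin> free_vars p - K \<longrightarrow> z i = x i) \<and> P z)" (is "?L \<longleftrightarrow> ?R") for x
  proof
    assume ?L
    then obtain z where z: "\<forall>i\<in>K. z i = x i" "P z" by blast
    let ?z = "\<lambda>i. if i \<in> free_vars p - K then z i else x i"
    have "holds ?z p = holds z p" using z(1) by (intro holds_cong) auto
    then have "P ?z" using z(2) p(2) by simp
    then show ?R by (intro exI[of _ ?z]) simp
  qed auto
  then show ?thesis using *[of "free_vars p - K"] by (simp add: finite_free_vars)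
qed

text \<open>
  Substituting \<open>0\<close> for the variables from \<open>n\<close> on bounds the free variables by \<open>n\<close> and changes
  nothing at points of the space.
\<close>

lemma definable_if_definable_pred:
  assumes "definable_pred M P"
  shows "definable M n {x \<in> topspace (Euclidean_space n). P x}"
proof -
  obtain p where p: "fml_over M p" "\<And>x. holds x p = P x"
    using assms by (auto simp: definable_pred_def)
  define \<sigma> where "\<sigma> i = (if i < n then Var i else Param 0)" for i
  have \<sigma>: "trm_over M (\<sigma> i)" "trm_vars (\<sigma> i) \<subseteq> {..<n}" for i by (simp_all add: \<sigma>_def)
  obtain q where q: "fml_over M q" "free_vars q \<subseteq> (\<Union>j\<in>free_vars p. trm_vars (\<sigma> j))"
    "\<And>x. holds x q = holds (\<lambda>j. trm_val x (\<sigma> j)) p"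
    using fml_subst[where \<sigma> = \<sigma>, OF p(1) \<sigma>(1)] by blast
  have "holds x q = P x" if "x \<in> topspace (Euclidean_space n)" for x
  proof -
    have "(\<lambda>j. trm_val x (\<sigma> j)) = x"
      using that by (auto simp: \<sigma>_def topspace_Euclidean_space)
    then show ?thesis by (simp add: q(3) p(2))
  qed
  then have "{x \<in> topspace (Euclidean_space n). P x} = {x \<in> topspace (Euclidean_space n). holds x q}"
    by auto
  moreover have "free_vars q \<subseteq> {..<n}" using q(2) \<sigma>(2) by blast
  ultimately show ?thesis unfolding definable_def using q(1) by blast
qed

definition trunc_point :: "nat \<Rightarrow> (nat \<Rightarrow> real) \<Rightarrow> nat \<Rightarrow> real" where
  "trunc_point n x = (\<lambda>i. if i < n then x i else 0)"

lemma definable_pred_if_definable: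
  assumes "definable M n X"
  shows "definable_pred M (\<lambda>x. trunc_point n x \<in> X)"
proof -
  obtain p where p: "fml_over M p" "free_vars p \<subseteq> {..<n}"
    "X = {x \<in> topspace (Euclidean_space n). holds x p}"
    using assms by (auto simp: definable_def)
  have "holds x p = (trunc_point n x \<in> X)" for x
  proof -
    have "holds x p = holds (trunc_point n x) p"
      using p(2) by (intro holds_cong) (auto simp: trunc_point_def)
    then show ?thesis using p(3) by (simp add: topspace_Euclidean_space trunc_point_def)
  qed
  then show ?thesis using p(1) unfolding definable_pred_def by blast
qed

lemma fml_over_expansion:
  assumes "expansion_of M N"
  shows "fml_over N p \<Longrightarrow> fml_over M p"
proof -
  have "trm_over N t \<Longrightarrow> trm_over M t" for t
    using assms by (induction t) (auto simp: expansion_of_def list_all_iff)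
  then show "fml_over N p \<Longrightarrow> fml_over M p"
    using assms by (induction p) (auto simp: expansion_of_def list_all_iff)
qed

lemma definable_pred_expansion:
  "expansion_of M N \<Longrightarrow> definable_pred N P \<Longrightarrow> definable_pred M P"
  unfolding definable_pred_def using fml_over_expansion by blast

lemma definable_expansion:
  "expansion_of M N \<Longrightarrow> definable N n X \<Longrightarrow> definable M n X"
  unfolding definable_def using fml_over_expansion by blast

lemma o_minimal_reduct:
  assumes "expansion_of M N" "o_minimal M"
  shows "o_minimal N"
  unfolding o_minimal_def
proof (intro allI impI)
  fix X assume "definable N 1 X"
  then have "definable M 1 X" by (rule definable_expansion[OF assms(1)])
  with assms(2)[unfolded o_minimal_def, THEN spec]
  show "\<exists>\<I>. finite \<I> \<and> (\<forall>I\<in>\<I>. point_or_open_interval I) \<and> (\<lambda>x. x 0) ` X = \<Union> \<I>"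
    by (rule mp)
qed

section \<open>Sets and functions of one variable\<close>

text \<open>
  Definability allows parameters, so o-minimality also applies to a line parallel to a coordinate
  axis through any point.
\<close>

lemma o_minimal_fibre:
  assumes "o_minimal M" "definable_pred M P"
  shows "\<exists>\<I>. finite \<I> \<and> (\<forall>I\<in>\<I>. point_or_open_interval I) \<and> {t. P (x(i := t))} = \<Union> \<I>"
proof -
  have "definable_pred M (\<lambda>y. P (x(i := y 0)))"
    by (rule definable_pred_subst[OF assms(2)]) (simp add: fun_upd_def definable_intros)
  then have "definable M 1 {y \<in> topspace (Euclidean_space 1). P (x(i := y 0))}"
    by (rule definable_if_definable_pred)
  then have "\<exists>\<I>. finite \<I> \<and> (\<forall>I\<in>\<I>. point_or_open_interval I) \<and>
      (\<lambda>x. x 0) ` {y \<in> topspace (Euclidean_space 1). P (x(i := y 0))} = \<Union> \<I>"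
    using assms(1) by (simp only: o_minimal_def)
  moreover have "(\<lambda>x. x 0) ` {y \<in> topspace (Euclidean_space 1). P (x(i := y 0))} = {t. P (x(i := t))}"
  proof (intro equalityI subsetI)
    fix t assume "t \<in> {t. P (x(i := t))}"
    then show "t \<in> (\<lambda>x. x 0) ` {y \<in> topspace (Euclidean_space 1). P (x(i := y 0))}"
      by (intro image_eqI[of _ _ "(\<lambda>_. 0)(0 := t)"]) (auto simp: topspace_Euclidean_space)
  qed auto
  ultimately show ?thesis by (simp only:)
qed

lemma o_minimal_countable_frontier:
  assumes "o_minimal M" "definable_pred M P"
  shows "countable (frontier {t. P (x(i := t))})"
proof -
  obtain \<I> where I: "finite \<I>" "\<And>I. I \<in> \<I> \<Longrightarrow> point_or_open_interval I" "{t. P (x(i := t))} = \<Union> \<I>"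
    using o_minimal_fibre[OF assms, of x i] by auto
  have "countable (frontier I)" if "point_or_open_interval I" for I
    using that unfolding point_or_open_interval_def
  proof (elim disjE exE)
    fix a b assume I: "I = {a<..<b}"
    have "frontier I \<subseteq> {a, b}"
      by (cases "a < b") (auto simp: I frontier_def interior_open)
    then show ?thesis by (rule countable_subset) simp
  next
    fix a assume I: "I = {a<..}"
    have "frontier I \<subseteq> {a}" by (auto simp: I frontier_def interior_open)
    then show ?thesis by (rule countable_subset) simp
  next
    fix a assume I: "I = {..<a}"
    have "frontier I \<subseteq> {a}" by (auto simp: I frontier_def interior_open)
    then show ?thesis by (rule countable_subset) simp
  qed (auto simp: frontier_def)
  then have "countable (\<Union>I\<in>\<I>. frontier I)"
    using I(1,2) by (intro countable_UN countable_finite[OF I(1)]) auto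
  moreover have "frontier (\<Union> \<I>) \<subseteq> (\<Union>I\<in>\<I>. frontier I)"
    using I(1)
  proof (induction \<I>)
    case (insert I \<I>)
    then show ?case using frontier_Un_subset[of I "\<Union> \<I>"] by auto
  qed simp
  ultimately have "countable (frontier (\<Union> \<I>))"
    by (rule countable_subset[rotated])
  then show ?thesis by (simp only: I(3))
qed

text \<open>
  A point or an interval either contains or misses a right neighbourhood of any given point.
\<close>

lemma o_minimal_right_germ:
  assumes "o_minimal M" "definable_pred M P"
  shows "eventually (\<lambda>t. P (x(i := t))) (at_right a) \<or> eventually (\<lambda>t. \<not> P (x(i := t))) (at_right a)"
proof -
  obtain \<I> where I: "finite \<I>" "\<And>I. I \<in> \<I> \<Longrightarrow> point_or_open_interval I" "{t. P (x(i := t))} = \<Union> \<I>"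
    using o_minimal_fibre[OF assms, of x i] by auto
  have "eventually (\<lambda>t. t \<in> I) (at_right a) \<or> eventually (\<lambda>t. t \<notin> I) (at_right a)"
    if "point_or_open_interval I" for I
    using that unfolding point_or_open_interval_def
  proof (elim disjE exE)
    fix c assume I: "I = {c}"
    show ?thesis
      by (cases "c > a") (auto simp: I eventually_at_right_field intro: exI[of _ c] exI[of _ "a + 1"])
  next
    fix c d assume I: "I = {c<..<d}"
    consider "c \<le> a" "a < d" | "c > a" | "d \<le> a" by linarith
    then show ?thesis
      by cases (auto simp: I eventually_at_right_field intro: exI[of _ c] exI[of _ d] exI[of _ "a + 1"])
  next
    fix c assume I: "I = {c<..}"
    show ?thesis
      by (cases "c > a") (auto simp: I eventually_at_right_field intro: exI[of _ c] exI[of _ "a + 1"])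
  next
    fix c assume I: "I = {..<c}"
    show ?thesis
      by (cases "c > a") (auto simp: I eventually_at_right_field intro: exI[of _ c] exI[of _ "a + 1"])
  qed auto
  then have dich: "eventually (\<lambda>t. t \<in> I) (at_right a) \<or> eventually (\<lambda>t. t \<notin> I) (at_right a)"
    if "I \<in> \<I>" for I
    using I(2) that by blast
  have "eventually (\<lambda>t. t \<in> \<Union> \<I>) (at_right a) \<or> eventually (\<lambda>t. t \<notin> \<Union> \<I>) (at_right a)"
  proof (cases "\<exists>I\<in>\<I>. eventually (\<lambda>t. t \<in> I) (at_right a)")
    case True
    then obtain I where "I \<in> \<I>" "eventually (\<lambda>t. t \<in> I) (at_right a)" by blast
    then have "eventually (\<lambda>t. t \<in> \<Union> \<I>) (at_right a)" by (auto elim: eventually_mono)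
    then show ?thesis ..
  next
    case False
    then have "eventually (\<lambda>t. \<forall>I\<in>\<I>. t \<notin> I) (at_right a)"
      using dich by (intro eventually_ball_finite I(1)) blast
    then show ?thesis by simp
  qed
  then show ?thesis by (simp flip: I(3))
qed

text \<open>
  Let \<open>C\<close> be the union of the frontiers of the preimages of the rational intervals. It is countable,
  and the function is continuous off \<open>C\<close>. The set of points of continuity is itself definable, so
  near the given point it contains an interval or misses one; the latter would make \<open>C\<close>
  uncountable.
\<close>

lemma o_minimal_eventually_isCont:
  assumes M: "expansion_of M real_field" "o_minimal M"
    and f: "definable_pred M (\<lambda>y. y 1 = f (y 0))"
  shows "eventually (\<lambda>t. isCont f t) (at_right a)"
proof -
  have f': "definable_pred M (\<lambda>y. y j = f (y i))" for i j
    using definable_pred_subst[OF f, of "\<lambda>y k. if k = 0 then y i else y j"] by (simp add: definable_intros)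
  define pre where "pre p q = {t. p < f t \<and> f t < q}" for p q
  have "definable_pred M (\<lambda>y. \<exists>v. v = f (y 0) \<and> p < v \<and> v < q)" for p q
    by (intro definable_intros f' M)
  from o_minimal_countable_frontier[OF M(2) this, where i = 0]
  have fr: "countable (frontier (pre p q))" for p q
    by (simp add: pre_def)
  define C where "C = (\<Union>(p, q)\<in>\<rat> \<times> \<rat>. frontier (pre p q))"
  have C: "countable C"
    unfolding C_def using fr by (auto simp: countable_rat)
  have cont: "isCont f t" if "t \<notin> C" for t
    unfolding isCont_def tendsto_iff
  proof (intro allI impI)
    fix e :: real assume "e > 0"
    obtain p where p: "p \<in> \<rat>" "f t - e < p" "p < f t"
      using Rats_dense_in_real[of "f t - e" "f t"] \<open>e > 0\<close> by auto
    obtain q where q: "q \<in> \<rat>" "f t < q" "q < f t + e"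
      using Rats_dense_in_real[of "f t" "f t + e"] \<open>e > 0\<close> by auto
    have "t \<in> pre p q" using p q by (simp add: pre_def)
    moreover have "t \<notin> frontier (pre p q)" using that p q by (auto simp: C_def)
    ultimately have "t \<in> interior (pre p q)"
      using closure_subset unfolding frontier_def by blast
    then have "eventually (\<lambda>u. u \<in> interior (pre p q)) (at t)"
      by (simp add: eventually_at_topological) (use open_interior in blast)
    then show "\<forall>\<^sub>F u in at t. dist (f u) (f t) < e"
    proof (rule eventually_mono)
      fix u assume "u \<in> interior (pre p q)"
      then have "u \<in> pre p q" using interior_subset by blast
      then show "dist (f u) (f t) < e" using p q by (auto simp: pre_def dist_real_def)
    qed
  qed
  (* The definition of continuity, arranged so that f occurs only in equations between variables. *)
  have "isCont f t \<longleftrightarrow> (\<forall>e. 0 < e \<longrightarrow> (\<exists>d. 0 < d \<and> (\<forall>u v w. v = f u \<longrightarrow> w = f t \<longrightarrow>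
          u < t + d \<longrightarrow> t < u + d \<longrightarrow> v < w + e \<and> w < v + e)))" for t
  proof -
    have "dist u v < d \<longleftrightarrow> u < v + d \<and> v < u + d" for u v d :: real
      by (auto simp: dist_real_def)
    then show ?thesis unfolding continuous_at_eps_delta by (simp add: imp_conjL)
  qed
  moreover have "definable_pred M (\<lambda>x. \<forall>e. 0 < e \<longrightarrow> (\<exists>d. 0 < d \<and> (\<forall>u v w. v = f u \<longrightarrow> w = f (x 0) \<longrightarrow>
          u < x 0 + d \<longrightarrow> x 0 < u + d \<longrightarrow> v < w + e \<and> w < v + e)))"
    by (intro definable_intros f' M)
  ultimately have "definable_pred M (\<lambda>x. isCont f (x 0))" by simp
  from o_minimal_right_germ[OF M(2) this, of _ 0 a]
  have "eventually (\<lambda>t. isCont f t) (at_right a) \<or> eventually (\<lambda>t. \<not> isCont f t) (at_right a)" by simp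
  moreover have False if "eventually (\<lambda>t. \<not> isCont f t) (at_right a)"
  proof -
    obtain b where "b > a" "\<And>t. a < t \<Longrightarrow> t < b \<Longrightarrow> \<not> isCont f t"
      using \<open>eventually _ _\<close> by (auto simp: eventually_at_right_field)
    then have "{a<..<b} \<subseteq> C" using cont greaterThanLessThan_iff by blast
    then show False using C \<open>b > a\<close> countable_subset uncountable_open_interval by blast
  qed
  ultimately show ?thesis by blast
qed


section \<open>Definable choice with a generic parameter\<close>

text \<open>
  Here \<open>a\<close> is the infimum of \<open>S\<close> and \<open>b\<close> is the right end of the largest interval \<open>(a, b)\<close> contained
  in \<open>S\<close>, with \<open>b = a\<close> if there is none.
  Both bounds are spelled out in first-order terms so that the choice is visibly definable.
\<close>

definition is_pick :: "real \<Rightarrow> (real \<Rightarrow> bool) \<Rightarrow> real \<Rightarrow> bool" where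
  "is_pick s S t \<longleftrightarrow> (\<exists>a b.
     (\<forall>u. S u \<longrightarrow> a \<le> u) \<and> (\<forall>c. (\<forall>u. S u \<longrightarrow> c \<le> u) \<longrightarrow> c \<le> a) \<and>
     (\<forall>c. a \<le> c \<and> (\<forall>u. a < u \<and> u < c \<longrightarrow> S u) \<longrightarrow> c \<le> b) \<and>
     (\<forall>d. (\<forall>c. a \<le> c \<and> (\<forall>u. a < u \<and> u < c \<longrightarrow> S u) \<longrightarrow> c \<le> d) \<longrightarrow> b \<le> d) \<and>
     t = a + s * (b - a))"

definition pick :: "real \<Rightarrow> (real \<Rightarrow> bool) \<Rightarrow> real" where
  "pick s S = (if \<exists>t. is_pick s S t then THE t. is_pick s S t else 0)"

lemma is_pick_unique:
  assumes "is_pick s S t" "is_pick s S t'"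
  shows "t = t'"
proof -
  define I where "I a b \<longleftrightarrow> 
     (\<forall>u. S u \<longrightarrow> a \<le> u) \<and> (\<forall>c. (\<forall>u. S u \<longrightarrow> c \<le> u) \<longrightarrow> c \<le> a) \<and>
     (\<forall>c. a \<le> c \<and> (\<forall>u. a < u \<and> u < c \<longrightarrow> S u) \<longrightarrow> c \<le> b) \<and>
     (\<forall>d. (\<forall>c. a \<le> c \<and> (\<forall>u. a < u \<and> u < c \<longrightarrow> S u) \<longrightarrow> c \<le> d) \<longrightarrow> b \<le> d)" for a b
  obtain a b where ab: "I a b" "t = a + s * (b - a)"
    using assms(1) unfolding is_pick_def I_def by blast
  obtain a' b' where ab': "I a' b'" "t' = a' + s * (b' - a')"
    using assms(2) unfolding is_pick_def I_def by blast
  have "a = a'"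
    using ab(1) ab'(1) unfolding I_def by (intro antisym) blast+
  moreover from this have "b = b'"
    using ab(1) ab'(1) unfolding I_def by (intro antisym) blast+
  ultimately show ?thesis using ab(2) ab'(2) by simp
qed

lemma pick_eqI: "is_pick s S t \<Longrightarrow> pick s S = t"
  unfolding pick_def using is_pick_unique by auto

lemma eq_pick_iff:
  "t = pick s S \<longleftrightarrow> is_pick s S t \<or> \<not> (\<exists>u. is_pick s S u) \<and> t = 0"
proof (cases "\<exists>u. is_pick s S u")
  case True
  then obtain u where "is_pick s S u" by blast
  then show ?thesis using pick_eqI is_pick_unique by metis
qed (simp add: pick_def)

lemma definable_pred_pick:
  assumes M: "expansion_of M real_field"
    and Q: "definable_pred M (\<lambda>y. Q (y 0) (\<lambda>i. y (Suc i)))"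
    and f: "term_fun M f"
  shows "definable_pred M (\<lambda>x. f x = pick s (\<lambda>t. Q t x))"
proof -
  have Q': "definable_pred M (\<lambda>x. Q (g x) (e x))"
    if "term_fun M g" "\<And>i. term_fun M (\<lambda>x. e x i)" for g e
  proof -
    have "term_fun M (\<lambda>x. case i of 0 \<Rightarrow> g x | Suc j \<Rightarrow> e x j)" for i
      using that by (cases i) auto
    from definable_pred_subst[OF Q, of "\<lambda>x i. case i of 0 \<Rightarrow> g x | Suc j \<Rightarrow> e x j", OF this]
    show ?thesis by simp
  qed
  have "definable_pred M (\<lambda>y. y 0 = pick s (\<lambda>t. Q t (\<lambda>i. y (Suc i))))"
    unfolding eq_pick_iff is_pick_def by (intro definable_intros Q' M)
  moreover have "term_fun M (\<lambda>x. case i of 0 \<Rightarrow> f x | Suc j \<Rightarrow> x j)" for i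
    using f by (cases i) (auto intro: term_fun_var)
  ultimately show ?thesis
    using definable_pred_subst[of M _ "\<lambda>x i. case i of 0 \<Rightarrow> f x | Suc j \<Rightarrow> x j"] by fastforce
qed

text \<open>
  The dichotomy of right germs at the infimum of \<open>S\<close> decides between the two cases: the one formula
  for \<open>pick\<close> returns the infimum itself when it is isolated in \<open>S\<close>, and moves through an interval
  inside \<open>S\<close> otherwise.
\<close>

lemma pick_cases:
  assumes S: "S u0" "\<And>u. S u \<Longrightarrow> lo \<le> u \<and> u \<le> hi"
    and germ: "\<And>a. eventually S (at_right a) \<or> eventually (\<lambda>u. \<not> S u) (at_right a)"
  obtains (isolated) t \<delta> where "S t" "\<delta> > 0" "\<And>u. S u \<Longrightarrow> \<bar>u - t\<bar> < \<delta> \<Longrightarrow> u = t"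
      "\<And>s. pick s S = t"
    | (generic) a b where "a < b" "\<And>u. a < u \<Longrightarrow> u < b \<Longrightarrow> S u"
      "\<And>s. pick s S = a + s * (b - a)"
proof -
  define a where "a = Inf {u. S u}"
  have bdd: "bdd_below {u. S u}" "{u. S u} \<noteq> {}" using S by (auto simp: bdd_below_def)
  have a_le: "a \<le> u" if "S u" for u
    using cInf_lower[of u "{u. S u}"] bdd that by (simp add: a_def)
  have a_ge: "c \<le> a" if "\<And>u. S u \<Longrightarrow> c \<le> u" for c
    using cInf_greatest[of "{u. S u}" c] bdd that by (simp add: a_def)
  define B where "B = {c. a \<le> c \<and> (\<forall>u. a < u \<and> u < c \<longrightarrow> S u)}"
  define b where "b = Sup B"
  have "a \<in> B" by (auto simp: B_def)
  have B_le: "c \<le> max a hi" if "c \<in> B" for c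
  proof (rule ccontr)
    assume "\<not> c \<le> max a hi"
    then obtain u where "max a hi < u" "u < c" using dense[of "max a hi" c] by (meson not_le)
    then show False using that S(2)[of u] by (auto simp: B_def)
  qed
  then have Bbdd: "bdd_above B" by (auto simp: bdd_above_def)
  have le_b: "c \<le> b" if "c \<in> B" for c
    unfolding b_def by (rule cSup_upper[OF that Bbdd])
  have b_le: "b \<le> d" if "\<And>c. c \<in> B \<Longrightarrow> c \<le> d" for d
    unfolding b_def using \<open>a \<in> B\<close> that by (intro cSup_least) auto
  have pick: "pick s S = a + s * (b - a)" for s
  proof (rule pick_eqI, unfold is_pick_def, rule exI[of _ a], rule exI[of _ b], intro conjI)
    show "\<forall>c. a \<le> c \<and> (\<forall>u. a < u \<and> u < c \<longrightarrow> S u) \<longrightarrow> c \<le> b"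
      using le_b by (simp add: B_def)
    show "\<forall>d. (\<forall>c. a \<le> c \<and> (\<forall>u. a < u \<and> u < c \<longrightarrow> S u) \<longrightarrow> c \<le> d) \<longrightarrow> b \<le> d"
      using b_le by (simp add: B_def)
  qed (use a_le a_ge in auto)
  show ?thesis
  proof (cases "eventually S (at_right a)")
    case True
    then obtain c where c: "c > a" "\<And>u. a < u \<Longrightarrow> u < c \<Longrightarrow> S u"
      by (auto simp: eventually_at_right_field)
    then have "c \<in> B" by (simp add: B_def)
    show ?thesis
    proof (rule generic)
      show "pick s S = a + s * (b - a)" for s by (rule pick)
      show "a < b" using le_b[OF \<open>c \<in> B\<close>] c by simp
      fix u assume u: "a < u" "u < b"
      then obtain d where "d \<in> B" "u < d"
        using less_cSup_iff[of B u] \<open>a \<in> B\<close> Bbdd by (auto simp: b_def)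
      then show "S u" using u(1) by (simp add: B_def)
    qed
  next
    case False
    then have "eventually (\<lambda>u. \<not> S u) (at_right a)" using germ by blast
    then obtain c where c: "c > a" "\<And>u. a < u \<Longrightarrow> u < c \<Longrightarrow> \<not> S u"
      by (auto simp: eventually_at_right_field)
    have "S a"
    proof (rule ccontr)
      assume "\<not> S a"
      then have "c \<le> u" if "S u" for u
        using a_le[OF that] c(2)[of u] that by (cases "u = a") force+
      then show False using a_ge[of c] c by simp
    qed
    have "d \<le> a" if "d \<in> B" for d
    proof (rule ccontr)
      assume "\<not> d \<le> a"
      then obtain u where "a < u" "u < min c d" using dense[of a "min c d"] c(1) by auto
      then show False using that c(2)[of u] by (simp add: B_def)
    qed
    then have "b = a" using b_le[of a] le_b[OF \<open>a \<in> B\<close>] by simp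
    show ?thesis
    proof (rule isolated)
      show "u = a" if "S u" "\<bar>u - a\<bar> < c - a" for u
        using a_le[OF that(1)] c(2)[of u] that by (cases "u = a") auto
      show "S a" "c - a > 0" by (fact \<open>S a\<close>) (use c(1) in simp)
      show "pick s S = a" for s using pick \<open>b = a\<close> by simp
    qed
  qed
qed

text \<open>
  In the second case the choice is an injective affine function of \<open>s\<close>, so only countably many \<open>s\<close>
  can hit a countable set.
\<close>

lemma pick_generic:
  assumes S: "S u0" "\<And>u. S u \<Longrightarrow> lo \<le> u \<and> u \<le> hi"
    and germ: "\<And>a. eventually S (at_right a) \<or> eventually (\<lambda>u. \<not> S u) (at_right a)"
    and C: "countable C"
  shows "\<exists>B. countable B \<and> (\<forall>s\<in>{0<..<1} - B. S (pick s S) \<and>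
           (pick s S \<in> C \<longrightarrow> (\<exists>\<delta>>0. \<forall>u. S u \<longrightarrow> \<bar>u - pick s S\<bar> < \<delta> \<longrightarrow> u = pick s S)))"
  using S germ
proof (rule pick_cases)
  fix t \<delta> assume "S t" "\<delta> > 0" "\<And>u. S u \<Longrightarrow> \<bar>u - t\<bar> < \<delta> \<Longrightarrow> u = t" "\<And>s. pick s S = t"
  then show ?thesis by (intro exI[of _ "{}"]) auto
next
  fix a b assume generic: "a < b" "\<And>u. a < u \<Longrightarrow> u < b \<Longrightarrow> S u"
    "\<And>s. pick s S = a + s * (b - a)"
  let ?B = "(\<lambda>c. (c - a) / (b - a)) ` C"
  have "S (pick s S) \<and> pick s S \<notin> C" if "s \<in> {0<..<1} - ?B" for s
  proof
    have "0 < s * (b - a)" "s * (b - a) < 1 * (b - a)"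
      using that generic(1) by (auto intro: mult_strict_right_mono)
    then show "S (pick s S)"
      using generic(2)[of "a + s * (b - a)"] unfolding generic(3) by simp
    have "s = (pick s S - a) / (b - a)" using generic(1,3) by simp
    then show "pick s S \<notin> C" using that by blast
  qed
  then show ?thesis using C by (intro exI[of _ ?B]) auto
qed

section \<open>Density in the fibres\<close>

text \<open>
  The predicate \<open>extends K A\<close> is the projection of \<open>A\<close> to the coordinates in \<open>K\<close>, regarded as a predicate
  on full sequences so that all predicates have the same type.
\<close>

definition extends :: "nat set \<Rightarrow> ((nat \<Rightarrow> real) \<Rightarrow> bool) \<Rightarrow> (nat \<Rightarrow> real) \<Rightarrow> bool" where
  "extends K A y \<longleftrightarrow> (\<exists>z. (\<forall>i\<in>K. z i = y i) \<and> A z)"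

text \<open>
  Boxes are lists of constraints on single coordinates: there are countably many of them, and a box
  is narrowed in one coordinate by adding one constraint.
\<close>

definition in_box :: "(nat \<times> rat \<times> rat) list \<Rightarrow> (nat \<Rightarrow> real) \<Rightarrow> bool" where
  "in_box l z \<longleftrightarrow> (\<forall>(i, p, q)\<in>set l. of_rat p < z i \<and> z i < of_rat q)"

text \<open>
  Density of \<open>B\<close> in \<open>A\<close>, inside the fibre over the \<open>K\<close>-coordinates of \<open>y\<close>, tested on rational
  boxes.
\<close>

definition dense_over ::
  "nat set \<Rightarrow> ((nat \<Rightarrow> real) \<Rightarrow> bool) \<Rightarrow> ((nat \<Rightarrow> real) \<Rightarrow> bool) \<Rightarrow> (nat \<Rightarrow> real) \<Rightarrow> bool" where
  "dense_over K A B y \<longleftrightarrow>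
     (\<forall>l. extends K (\<lambda>z. A z \<and> in_box l z) y \<longrightarrow> extends K (\<lambda>z. B z \<and> in_box l z) y)"

lemma extends_insert:
  assumes "j \<notin> K"
  shows "extends K A y \<longleftrightarrow> (\<exists>t. extends (insert j K) A (y(j := t)))"
proof
  assume "extends K A y"
  then obtain z where "\<forall>i\<in>K. z i = y i" "A z" by (auto simp: extends_def)
  then have "extends (insert j K) A (y(j := z j))"
    unfolding extends_def by (intro exI[of _ z]) simp
  then show "\<exists>t. extends (insert j K) A (y(j := t))" ..
next
  assume "\<exists>t. extends (insert j K) A (y(j := t))"
  then obtain t z where "\<forall>i\<in>insert j K. z i = (y(j := t)) i" "A z" by (auto simp: extends_def)
  then show "extends K A y"
    unfolding extends_def using assms by (intro exI[of _ z]) auto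
qed

lemma extends_cong: "(\<And>i. i \<in> K \<Longrightarrow> x i = y i) \<Longrightarrow> extends K A x = extends K A y"
  unfolding extends_def by simp

lemma definable_pred_extends: "definable_pred M A \<Longrightarrow> definable_pred M (extends K A)"
  using definable_pred_project[of M A K] by (simp add: extends_def[abs_def])

lemma definable_pred_in_box:
  assumes "expansion_of M real_field"
  shows "definable_pred M (in_box l)"
proof (induction l)
  case Nil
  then show ?case by (simp add: in_box_def[abs_def] definable_pred_const)
next
  case (Cons c l)
  obtain i p q where c: "c = (i, p, q)" by (cases c)
  have "in_box (c # l) = (\<lambda>z. (real_of_rat p < z i \<and> z i < real_of_rat q) \<and> in_box l z)"
    by (auto simp: in_box_def fun_eq_iff c)
  then show ?case using Cons by (auto intro!: definable_intros assms)
qed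

text \<open>
  Suppose \<open>A\<close> meets a box in the smaller fibre, the one over \<open>t\<close>. Narrowing the box in coordinate \<open>j\<close>
  around \<open>t\<close> and using density in the larger fibre gives points of \<open>B\<close> in the box whose \<open>j\<close>-th
  coordinate is arbitrarily close to \<open>t\<close>. Thus \<open>t\<close> is in the closure of the projection of \<open>B\<close> cut with
  the box. If \<open>t\<close> is isolated among the possible values, one of these points lies over \<open>t\<close> itself; if
  \<open>t\<close> is not in the frontier of the projection, it is in the projection.
\<close>

lemma dense_over_insert:
  assumes "j \<notin> K" and BA: "\<And>z. B z \<Longrightarrow> A z" and dense: "dense_over K A B y"
    and t: "(\<exists>\<delta>>0. \<forall>u. extends (insert j K) A (y(j := u)) \<longrightarrow> \<bar>u - t\<bar> < \<delta> \<longrightarrow> u = t) \<or>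
       (\<forall>l. t \<notin> frontier {u. extends (insert j K) (\<lambda>z. B z \<and> in_box l z) (y(j := u))})"
  shows "dense_over (insert j K) A B (y(j := t))"
  unfolding dense_over_def
proof (intro allI impI)
  fix l
  let ?b = "{u. extends (insert j K) (\<lambda>z. B z \<and> in_box l z) (y(j := u))}"
  assume "extends (insert j K) (\<lambda>z. A z \<and> in_box l z) (y(j := t))"
  then obtain z where z: "\<forall>i\<in>insert j K. z i = (y(j := t)) i" "A z" "in_box l z"
    by (auto simp: extends_def)
  have near: "\<exists>u\<in>?b. \<bar>u - t\<bar> < \<delta>" if pos: "\<delta> > 0" for \<delta>
  proof -
    obtain p where p: "t - \<delta> < of_rat p" "of_rat p < t"
      using of_rat_dense[of "t - \<delta>" t] pos by auto
    obtain q where q: "t < of_rat q" "of_rat q < t + \<delta>"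
      using of_rat_dense[of t "t + \<delta>"] pos by auto
    have "in_box ((j, p, q) # l) z" using z p q by (auto simp: in_box_def)
    moreover have "\<forall>i\<in>K. z i = y i" using z(1) assms(1) by auto
    ultimately have "extends K (\<lambda>z. A z \<and> in_box ((j, p, q) # l) z) y"
      using z(2) unfolding extends_def by blast
    then have "extends K (\<lambda>z. B z \<and> in_box ((j, p, q) # l) z) y"
      using dense unfolding dense_over_def by blast
    then obtain w where w: "\<forall>i\<in>K. w i = y i" "B w" "in_box ((j, p, q) # l) w"
      by (auto simp: extends_def)
    have "w j \<in> ?b"
      using w by (auto simp: extends_def in_box_def intro!: exI[of _ w])
    moreover have "\<bar>w j - t\<bar> < \<delta>" using w(3) p q by (auto simp: in_box_def)
    ultimately show ?thesis by blast
  qed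
  have "t \<in> ?b"
  proof (cases "\<exists>\<delta>>0. \<forall>u. extends (insert j K) A (y(j := u)) \<longrightarrow> \<bar>u - t\<bar> < \<delta> \<longrightarrow> u = t")
    case True
    then obtain \<delta> where \<delta>: "\<delta> > 0"
      "\<And>u. extends (insert j K) A (y(j := u)) \<Longrightarrow> \<bar>u - t\<bar> < \<delta> \<Longrightarrow> u = t" by blast
    obtain u where u: "u \<in> ?b" "\<bar>u - t\<bar> < \<delta>" using near[OF \<delta>(1)] by blast
    then have "extends (insert j K) A (y(j := u))" using BA by (auto simp: extends_def)
    then show ?thesis using u \<delta>(2) by blast
  next
    case False
    then have "t \<notin> frontier ?b" using t by blast
    moreover have "t \<in> closure ?b"
      unfolding closure_approachable using near by (auto simp: dist_real_def)
    ultimately show ?thesis using interior_subset unfolding frontier_def by blast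
  qed
  then show "extends (insert j K) (\<lambda>z. B z \<and> in_box l z) (y(j := t))" by simp
qed

text \<open>
  The coordinate with index \<open>n\<close> carries the parameter \<open>\<rho>\<close> of the curve, so that a definable family of
  subsets of real \<open>n\<close>-space is a single predicate.
\<close>

definition curve_point :: "nat \<Rightarrow> (nat \<Rightarrow> real \<Rightarrow> real) \<Rightarrow> real \<Rightarrow> nat \<Rightarrow> real" where
  "curve_point n \<gamma> \<rho> = (\<lambda>i. if i < n then \<gamma> i \<rho> else \<rho>)"

text \<open>
  The same parameter \<open>s\<close> has to serve for all \<open>r k\<close>. For each \<open>k\<close> the values to be avoided form the
  countable set \<open>C k\<close>, a union of frontiers over all rational boxes, so each \<open>k\<close> excludes countably many
  \<open>s\<close> and all of them together do not exhaust the interval \<open>(0, 1)\<close>. The choice uses only \<open>A\<close>, so it is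
  definable in \<open>N\<close>, whereas the frontiers come from sets definable in \<open>M\<close>.
\<close>

lemma definable_generic_curve_step:
  fixes r :: "nat \<Rightarrow> real"
  assumes N: "expansion_of N real_field" "o_minimal N" and M: "expansion_of M real_field" "o_minimal M"
    and A: "definable_pred N A" and B: "definable_pred M B" and BA: "\<And>z. B z \<Longrightarrow> A z"
    and bounded: "\<And>z i. A z \<Longrightarrow> i < n \<Longrightarrow> c i - z n \<le> z i \<and> z i \<le> c i + z n"
    and j: "j < n" and K: "K = insert n {..<j}"
    and \<gamma>: "definable_pred N (\<lambda>y. \<forall>i<j. y i = \<gamma> i (y n))"
    and ext: "\<And>k. extends K A (curve_point n \<gamma> (r k))"
    and dense: "\<And>k. dense_over K A B (curve_point n \<gamma> (r k))"
  shows "\<exists>g. definable_pred N (\<lambda>y. \<forall>i<Suc j. y i = (\<gamma>(j := g)) i (y n)) \<and>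
     (\<forall>k. extends (insert j K) A (curve_point n (\<gamma>(j := g)) (r k)) \<and>
          dense_over (insert j K) A B (curve_point n (\<gamma>(j := g)) (r k)))"
proof -
  define y where "y k = curve_point n \<gamma> (r k)" for k
  define S where "S x u = extends (insert j K) A (x(j := u))" for x u
  have jK: "j \<notin> K" using j K by simp
  define b where "b k l = {u. extends (insert j K) (\<lambda>z. B z \<and> in_box l z) ((y k)(j := u))}" for k l
  define C where "C k = (\<Union>l. frontier (b k l))" for k
  have "countable (frontier (b k l))" for k l
    unfolding b_def by (intro o_minimal_countable_frontier[OF M(2)] definable_pred_extends
        definable_pred_conj B definable_pred_in_box M(1))
  then have C: "countable (C k)" for k unfolding C_def by simp
  have "\<exists>D. countable D \<and> (\<forall>s\<in>{0<..<1} - D. S (y k) (pick s (S (y k))) \<and>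
      (pick s (S (y k)) \<in> C k \<longrightarrow>
        (\<exists>\<delta>>0. \<forall>u. S (y k) u \<longrightarrow> \<bar>u - pick s (S (y k))\<bar> < \<delta> \<longrightarrow> u = pick s (S (y k)))))" for k
  proof -
    obtain u0 where u0: "S (y k) u0"
      using ext[of k] extends_insert[OF jK] by (auto simp: S_def y_def)
    show ?thesis
    proof (rule pick_generic[where S = "S (y k)" and C = "C k", OF u0 _ _ C])
      fix u assume "S (y k) u"
      then obtain z where z: "\<forall>i\<in>insert j K. z i = ((y k)(j := u)) i" "A z"
        by (auto simp: S_def extends_def)
      then have "z j = u" "z n = r k" using j by (auto simp: K y_def curve_point_def)
      then show "c j - r k \<le> u \<and> u \<le> c j + r k" using bounded[OF z(2) j] by simp
    next
      fix a
      show "eventually (S (y k)) (at_right a) \<or> eventually (\<lambda>u. \<not> S (y k) u) (at_right a)"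
        unfolding S_def[abs_def] by (intro o_minimal_right_germ[OF N(2)] definable_pred_extends A)
    qed
  qed
  then obtain D where D: "\<And>k. countable (D k)"
    "\<And>k s. s \<in> {0<..<1} - D k \<Longrightarrow> S (y k) (pick s (S (y k)))"
    "\<And>k s. s \<in> {0<..<1} - D k \<Longrightarrow> pick s (S (y k)) \<in> C k \<Longrightarrow>
      \<exists>\<delta>>0. \<forall>u. S (y k) u \<longrightarrow> \<bar>u - pick s (S (y k))\<bar> < \<delta> \<longrightarrow> u = pick s (S (y k))"
    by metis
  have "\<not> {0<..<1} \<subseteq> (\<Union>k. D k)"
    using D(1) countable_subset uncountable_open_interval[of 0 1] by (metis countable_UN countableI_type zero_less_one)
  then obtain s where s: "\<And>k. s \<in> {0<..<1} - D k" by blast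
  define g where "g \<rho> = pick s (S (curve_point n \<gamma> \<rho>))" for \<rho>
  have cp: "curve_point n (\<gamma>(j := g)) \<rho> = (curve_point n \<gamma> \<rho>)(j := g \<rho>)" for \<rho>
    using j by (auto simp: curve_point_def fun_eq_iff)
  show ?thesis
  proof (intro exI[of _ g] conjI allI)
    (* On the graph of the earlier coordinates the fibre depends on the parameter alone. *)
    have "(\<forall>i<Suc j. x i = (\<gamma>(j := g)) i (x n)) \<longleftrightarrow>
          (\<forall>i<j. x i = \<gamma> i (x n)) \<and> x j = pick s (S x)" for x
    proof -
      have "pick s (S x) = g (x n)" if "\<forall>i<j. x i = \<gamma> i (x n)"
      proof -
        have "S x u = S (curve_point n \<gamma> (x n)) u" for u
          unfolding S_def using that j by (intro extends_cong) (auto simp: K curve_point_def)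
        then have "S x = S (curve_point n \<gamma> (x n))" by blast
        then show ?thesis by (simp add: g_def)
      qed
      then show ?thesis by (auto simp: All_less_Suc)
    qed
    moreover have "definable_pred N (\<lambda>x. x j = pick s (\<lambda>u. S x u))"
    proof (intro definable_pred_pick N term_fun_var)
      have "term_fun N (\<lambda>y. ((\<lambda>i. y (Suc i))(j := y 0)) i)" for i
        by (simp add: fun_upd_def definable_intros)
      from definable_pred_subst[OF definable_pred_extends[OF A, of "insert j K"] this]
      show "definable_pred N (\<lambda>y. S (\<lambda>i. y (Suc i)) (y 0))" by (simp only: S_def)
    qed
    ultimately show "definable_pred N (\<lambda>y. \<forall>i<Suc j. y i = (\<gamma>(j := g)) i (y n))"
      using definable_pred_conj[OF \<gamma>] by simp
  next
    fix k
    have g: "g (r k) = pick s (S (y k))" by (simp add: g_def y_def)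
    show "extends (insert j K) A (curve_point n (\<gamma>(j := g)) (r k))"
      unfolding cp g using D(2)[OF s] by (simp add: S_def y_def)
    show "dense_over (insert j K) A B (curve_point n (\<gamma>(j := g)) (r k))"
      unfolding cp g
    proof (rule dense_over_insert[OF jK BA dense])
      show "(\<exists>\<delta>>0. \<forall>u. extends (insert j K) A ((curve_point n \<gamma> (r k))(j := u)) \<longrightarrow>
          \<bar>u - pick s (S (y k))\<bar> < \<delta> \<longrightarrow> u = pick s (S (y k))) \<or>
        (\<forall>l. pick s (S (y k)) \<notin>
          frontier {u. extends (insert j K) (\<lambda>z. B z \<and> in_box l z) ((curve_point n \<gamma> (r k))(j := u))})"
        using D(3)[OF s, of k] unfolding C_def b_def S_def y_def[symmetric] by blast
    qed
  qed
qed

lemma definable_generic_curve: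
  fixes r :: "nat \<Rightarrow> real"
  assumes N: "expansion_of N real_field" "o_minimal N" and M: "expansion_of M real_field" "o_minimal M"
    and A: "definable_pred N A" and B: "definable_pred M B" and BA: "\<And>z. B z \<Longrightarrow> A z"
    and bounded: "\<And>z i. A z \<Longrightarrow> i < n \<Longrightarrow> c i - z n \<le> z i \<and> z i \<le> c i + z n"
    and ext: "\<And>k. extends {n} A (\<lambda>_. r k)" and dense: "\<And>k. dense_over {n} A B (\<lambda>_. r k)"
  shows "\<exists>\<gamma>. definable_pred N (\<lambda>y. \<forall>i<n. y i = \<gamma> i (y n)) \<and>
     (\<forall>k. extends {..n} B (curve_point n \<gamma> (r k)))"
proof -
  have "j \<le> n \<Longrightarrow> \<exists>\<gamma>. definable_pred N (\<lambda>y. \<forall>i<j. y i = \<gamma> i (y n)) \<and>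
     (\<forall>k. extends (insert n {..<j}) A (curve_point n \<gamma> (r k)) \<and>
          dense_over (insert n {..<j}) A B (curve_point n \<gamma> (r k)))" for j
  proof (induction j)
    case 0
    have "curve_point n (\<lambda>_ \<rho>. \<rho>) (r k) = (\<lambda>_. r k)" for k by (simp add: curve_point_def)
    then show ?case
      using ext dense by (intro exI[of _ "\<lambda>_ \<rho>. \<rho>"]) (simp add: definable_pred_const)
  next
    case (Suc j)
    then obtain \<gamma> where \<gamma>: "definable_pred N (\<lambda>y. \<forall>i<j. y i = \<gamma> i (y n))"
      "\<And>k. extends (insert n {..<j}) A (curve_point n \<gamma> (r k))"
      "\<And>k. dense_over (insert n {..<j}) A B (curve_point n \<gamma> (r k))" by auto
    have "insert n {..<Suc j} = insert j (insert n {..<j})" by auto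
    moreover have "\<exists>g. definable_pred N (\<lambda>y. \<forall>i<Suc j. y i = (\<gamma>(j := g)) i (y n)) \<and>
        (\<forall>k. extends (insert j (insert n {..<j})) A (curve_point n (\<gamma>(j := g)) (r k)) \<and>
          dense_over (insert j (insert n {..<j})) A B (curve_point n (\<gamma>(j := g)) (r k)))"
      by (rule definable_generic_curve_step[where c = c, OF N M A B BA bounded _ refl \<gamma>])
        (use Suc.prems in simp_all)
    ultimately show ?case by (elim exE) (simp only:, rule exI)
  qed
  from this[of n] obtain \<gamma> where \<gamma>: "definable_pred N (\<lambda>y. \<forall>i<n. y i = \<gamma> i (y n))"
     "\<And>k. extends (insert n {..<n}) A (curve_point n \<gamma> (r k))"
     "\<And>k. dense_over (insert n {..<n}) A B (curve_point n \<gamma> (r k))" by auto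
  have "extends {..n} B (curve_point n \<gamma> (r k))" for k
  proof -
    have "insert n {..<n} = {..n}" by auto
    then show ?thesis
      using \<gamma>(2,3)[of k] unfolding dense_over_def by (auto simp: in_box_def dest: spec[of _ "[]"])
  qed
  then show ?thesis using \<gamma>(1) by blast
qed


section \<open>Semialgebraic arcs\<close>

lemma connectedin_Euclidean_space:
  "connectedin (Euclidean_space n) S \<longleftrightarrow> connected S \<and> S \<subseteq> topspace (Euclidean_space n)"
  by (simp add: Euclidean_space_def connectedin_subtopology euclidean_product_topology)

lemma open_coordinate_box:
  fixes x y :: "nat \<Rightarrow> real"
  shows "open {z. \<forall>i<n. z i < x i \<and> y i < z i}"
proof -
  have "{z. \<forall>i<n. z i < x i \<and> y i < z i} = (\<Inter>i\<in>{..<n}. {z. z i < x i} \<inter> {z. y i < z i})"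
    by auto
  also have "open \<dots>"
    by (intro open_INT ballI open_Int open_Collect_less continuous_on_const
        continuous_on_product_coordinates) auto
  finally show ?thesis .
qed

lemma open_in_box: "open {z. in_box l z}"
proof -
  have "{z. in_box l z} =
      (\<Inter>c\<in>set l. {z. of_rat (fst (snd c)) < z (fst c)} \<inter> {z. z (fst c) < of_rat (snd (snd c))})"
    by (auto simp: in_box_def case_prod_beta)
  also have "open \<dots>"
    by (intro open_INT ballI open_Int open_Collect_less continuous_on_const
        continuous_on_product_coordinates) auto
  finally show ?thesis .
qed

text \<open>
  A connected set with more than one point has no isolated points.
\<close>

lemma connected_infinite_nearby_point:
  assumes T: "connectedin (Euclidean_space n) T" "infinite T" and "x \<in> T" and "(r::real) > 0"
  shows "\<exists>y\<in>T. (\<exists>i<n. y i \<noteq> x i) \<and> (\<forall>i<n. y i < x i + r \<and> x i < y i + r)"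
proof -
  have "T \<noteq> {a}" for a using T(2) by auto
  then have "x islimpt T"
    using T(1) \<open>x \<in> T\<close> by (intro connected_imp_perfect) (auto simp: connectedin_Euclidean_space)
  moreover have "x \<in> {y. \<forall>i<n. y i < x i + r \<and> x i - r < y i}" using \<open>r > 0\<close> by simp
  ultimately obtain y where y: "y \<in> T" "y \<in> {y. \<forall>i<n. y i < x i + r \<and> x i - r < y i}" "y \<noteq> x"
    using open_coordinate_box[of n "\<lambda>i. x i + r" "\<lambda>i. x i - r"] unfolding islimpt_def by meson
  have "y \<in> topspace (Euclidean_space n)" "x \<in> topspace (Euclidean_space n)"
    using T(1) y(1) \<open>x \<in> T\<close> by (auto simp: connectedin_Euclidean_space)
  then have "\<exists>i<n. y i \<noteq> x i"
    using y(3) by (auto simp: topspace_Euclidean_space fun_eq_iff) (metis not_le)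
  then show ?thesis using y by (intro bexI[of _ y]) (auto simp: algebra_simps)
qed

text \<open>
  The inequalities defining \<open>A\<close> from \<open>T\<close> are open conditions, as are those of a box, so density of
  \<open>X \<inter> T\<close> in \<open>T\<close> passes to \<open>A\<close>.
\<close>

lemma dense_over_near_point:
  fixes x :: "nat \<Rightarrow> real"
  assumes cl: "T \<subseteq> Euclidean_space n closure_of (X \<inter> T)"
  defines "A \<equiv> \<lambda>z. trunc_point n z \<in> T \<and> (\<exists>i<n. z i \<noteq> x i) \<and>
                    (\<forall>i<n. z i < x i + z n \<and> x i < z i + z n)"
  shows "dense_over {n} A (\<lambda>z. A z \<and> trunc_point n z \<in> X) y"
  unfolding dense_over_def
proof (intro allI impI)
  fix l assume "extends {n} (\<lambda>z. A z \<and> in_box l z) y"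
  then obtain z where z: "z n = y n" "A z" "in_box l z" by (auto simp: extends_def)
  then obtain i where i: "i < n" "z i \<noteq> x i" by (auto simp: A_def)
  (* A box may also constrain the coordinates from n on; these are kept from z. *)
  define ext where "ext w = (\<lambda>i. if i < n then w i else z i)" for w :: "nat \<Rightarrow> real"
  define U where "U = {w. w i \<noteq> x i} \<inter> {w. \<forall>i<n. w i < x i + z n \<and> x i - z n < w i} \<inter>
    ext -` {w. in_box l w}"
  have "continuous_on UNIV ext"
  proof (rule continuous_on_coordinatewise_then_product)
    show "continuous_on UNIV (\<lambda>w. ext w i)" for i
      by (cases "i < n") (simp_all add: ext_def)
  qed
  then have "open (ext -` {w. in_box l w})" using open_in_box by (intro open_vimage)
  moreover have "open {w. w i \<noteq> x i}"
    by (intro open_Collect_neq continuous_on_const continuous_on_product_coordinates)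
  ultimately have "open U"
    unfolding U_def by (intro open_Int open_coordinate_box)
  then have "openin (Euclidean_space n) (U \<inter> topspace (Euclidean_space n))"
    unfolding Euclidean_space_def by (auto simp: openin_subtopology euclidean_product_topology)
  moreover have tz: "trunc_point n z \<in> Euclidean_space n closure_of (X \<inter> T)"
    using z(2) cl by (auto simp: A_def)
  moreover have "ext (trunc_point n z) = z" by (auto simp: ext_def trunc_point_def)
  then have "trunc_point n z \<in> U"
    using z i by (auto simp: U_def trunc_point_def A_def algebra_simps)
  ultimately obtain w where w: "w \<in> X \<inter> T" "w \<in> U" "w \<in> topspace (Euclidean_space n)"
    unfolding in_closure_of by blast
  have "trunc_point n (ext w) = w"
    using w(3) by (auto simp: ext_def trunc_point_def topspace_Euclidean_space)
  moreover have "ext w n = z n" "\<And>k. k < n \<Longrightarrow> ext w k = w k" by (simp_all add: ext_def)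
  ultimately have "A (ext w) \<and> trunc_point n (ext w) \<in> X" "in_box l (ext w)" 
    using w i by (auto simp: A_def U_def algebra_simps)
  then show "extends {n} (\<lambda>z. (A z \<and> trunc_point n z \<in> X) \<and> in_box l z) y"
    unfolding extends_def using z(1) \<open>ext w n = z n\<close> by (intro exI[of _ "ext w"]) simp
qed

text \<open>
  The bound on the distance to \<open>x\<close> makes the curve extend continuously by \<open>x\<close> to the parameter \<open>0\<close>, so
  \<open>S\<close> is a continuous image of a half-open interval. A connected set with two points is
  uncountable.
\<close>

lemma semialgebraic_arc:
  fixes x :: "nat \<Rightarrow> real"
  assumes x: "x \<in> topspace (Euclidean_space n)" and "\<epsilon> > 0"
    and \<gamma>: "definable_pred real_field (\<lambda>y. \<forall>i<n. y i = \<gamma> i (y n))"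
    and cont: "\<And>i \<rho>. i < n \<Longrightarrow> 0 < \<rho> \<Longrightarrow> \<rho> < \<epsilon> \<Longrightarrow> isCont (\<gamma> i) \<rho>"
    and near: "\<And>i \<rho>. i < n \<Longrightarrow> 0 < \<rho> \<Longrightarrow> \<rho> < \<epsilon> \<Longrightarrow> \<bar>\<gamma> i \<rho> - x i\<bar> < \<rho>"
    and ne: "\<And>\<rho>. 0 < \<rho> \<Longrightarrow> \<rho> < \<epsilon> \<Longrightarrow> \<exists>i<n. \<gamma> i \<rho> \<noteq> x i"
  defines "S \<equiv> insert x ((\<lambda>\<rho>. trunc_point n (curve_point n \<gamma> \<rho>)) ` {0<..<\<epsilon>})"
  shows "infinite S" "connectedin (Euclidean_space n) S" "semialgebraic n S"
proof -
  define c where "c \<rho> = (\<lambda>i. if i < n then if \<rho> \<le> 0 then x i else \<gamma> i \<rho> else 0)" for \<rho>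
  have "c 0 = x" using x by (auto simp: c_def topspace_Euclidean_space)
  have c_pos: "trunc_point n (curve_point n \<gamma> \<rho>) = c \<rho>" if "\<rho> > 0" for \<rho>
    using that by (auto simp: c_def trunc_point_def curve_point_def)
  have "{0..<\<epsilon>} = insert 0 {0<..<\<epsilon>}" using \<open>\<epsilon> > 0\<close> by auto
  then have S: "S = c ` {0..<\<epsilon>}"
    using c_pos \<open>c 0 = x\<close> unfolding S_def by (auto simp: image_iff)
  have "continuous_on {0..<\<epsilon>} c"
  proof (intro continuous_on_coordinatewise_then_product)
    fix i
    show "continuous_on {0..<\<epsilon>} (\<lambda>\<rho>. c \<rho> i)"
    proof (cases "i < n")
      case i: True
      show ?thesis
        unfolding continuous_on_eq_continuous_within
      proof
        fix \<rho> assume \<rho>: "\<rho> \<in> {0..<\<epsilon>}"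
        show "continuous (at \<rho> within {0..<\<epsilon>}) (\<lambda>\<rho>. c \<rho> i)"
        proof (cases "\<rho> = 0")
          case True
          have "dist (c u i) (c 0 i) < e" if "u \<in> {0..<\<epsilon>}" "dist u 0 < e" for u e
            using that near[OF i, of u] i by (auto simp: c_def dist_real_def)
          then show ?thesis
            unfolding True continuous_within_eps_delta by blast
        next
          case False
          then have pos: "0 < \<rho>" "\<rho> < \<epsilon>" using \<rho> by auto
          have "\<forall>\<^sub>F u in nhds \<rho>. u \<in> {0<..}"
            using pos(1) by (intro eventually_nhds_in_open) auto
          then have "\<forall>\<^sub>F u in nhds \<rho>. c u i = \<gamma> i u"
            by (rule eventually_mono) (simp add: c_def i)
          then have "isCont (\<lambda>\<rho>. c \<rho> i) \<rho> = isCont (\<gamma> i) \<rho>" by (rule isCont_cong)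
          then show ?thesis using cont[OF i pos] by (simp add: continuous_at_imp_continuous_at_within)
        qed
      qed
    qed (simp add: c_def)
  qed
  then have conn: "connected S"
    unfolding S by (intro connected_continuous_image) auto
  moreover have sub: "S \<subseteq> topspace (Euclidean_space n)"
    unfolding S by (auto simp: c_def topspace_Euclidean_space)
  ultimately show "connectedin (Euclidean_space n) S" by (simp add: connectedin_Euclidean_space)
  obtain i where "i < n" "\<gamma> i (\<epsilon> / 2) \<noteq> x i" using ne[of "\<epsilon> / 2"] \<open>\<epsilon> > 0\<close> by auto
  then have "c (\<epsilon> / 2) \<noteq> x" using \<open>\<epsilon> > 0\<close> by (auto simp: c_def fun_eq_iff)
  moreover have "c (\<epsilon> / 2) \<in> S" using \<open>\<epsilon> > 0\<close> by (simp add: S)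
  moreover have "x \<in> S" by (simp add: S_def)
  ultimately show "infinite S"
    using connected_uncountable[OF conn] countable_finite by metis
  have R: "expansion_of real_field real_field" by (simp add: expansion_of_def)
  have "definable_pred real_field
      (\<lambda>y. (\<forall>i<n. y i = x i) \<or> (\<exists>a. (0 < (y(n := a)) n \<and> (y(n := a)) n < \<epsilon>) \<and>
        (\<forall>i<n. (y(n := a)) i = \<gamma> i ((y(n := a)) n))))"
    by (intro definable_pred_disj definable_pred_ex_coord[of _ "\<lambda>y. (0 < y n \<and> y n < \<epsilon>) \<and> (\<forall>i<n. y i = \<gamma> i (y n))"]
        definable_intros \<gamma> R)
  from definable_if_definable_pred[OF this, of n]
  have "semialgebraic n {y \<in> topspace (Euclidean_space n).
      (\<forall>i<n. y i = x i) \<or> (\<exists>a. (0 < a \<and> a < \<epsilon>) \<and> (\<forall>i<n. y i = \<gamma> i a))}"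
    by (simp add: semialgebraic_def cong: conj_cong)
  also have "{y \<in> topspace (Euclidean_space n).
      (\<forall>i<n. y i = x i) \<or> (\<exists>a. (0 < a \<and> a < \<epsilon>) \<and> (\<forall>i<n. y i = \<gamma> i a))} = S" (is "?L = S")
  proof (intro equalityI subsetI)
    fix y assume y: "y \<in> ?L"
    then have y0: "\<forall>i\<ge>n. y i = 0" by (simp add: topspace_Euclidean_space)
    from y consider "\<forall>i<n. y i = x i" | a where "0 < a" "a < \<epsilon>" "\<forall>i<n. y i = \<gamma> i a" by blast
    then show "y \<in> S"
    proof cases
      case 1
      then have "y i = x i" for i
        using y0 x by (cases "i < n") (auto simp: topspace_Euclidean_space)
      then have "y = x" by blast
      then show ?thesis by (simp add: S_def)
    next
      case 2
      then have "y = c a" using y0 by (auto simp: c_def fun_eq_iff)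
      then show ?thesis using 2 by (auto simp: S)
    qed
  next
    fix y assume "y \<in> S"
    then obtain a where a: "0 \<le> a" "a < \<epsilon>" "y = c a" by (auto simp: S)
    then have "y \<in> topspace (Euclidean_space n)" using sub S by auto
    moreover have "\<forall>i<n. y i = x i" if "a = 0" using that a(3) by (simp add: c_def)
    moreover have "0 < a" "\<forall>i<n. y i = \<gamma> i a" if "a \<noteq> 0" using that a(1,3) by (simp_all add: c_def)
    ultimately show "y \<in> ?L" using a(2) by blast
  qed
  finally show "semialgebraic n S" .
qed

text \<open>
  Apply the choice of a generic curve to the points of \<open>T\<close> close to \<open>x\<close>, with radii tending to \<open>0\<close>. Since
  the set of good parameters is definable in \<open>M\<close>, containing this sequence of radii forces it to contain
  an interval with left end \<open>0\<close>.
\<close>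

lemma arc_through_trace_point:
  assumes M: "expansion_of M real_field" "o_minimal M"
    and X: "definable M n X" and xX: "x \<in> X"
    and T: "infinite T" "connectedin (Euclidean_space n) T" "semialgebraic n T"
    and cl: "T \<subseteq> Euclidean_space n closure_of (X \<inter> T)" and xT: "x \<in> T"
  shows "\<exists>S\<subseteq>X. x \<in> S \<and> infinite S \<and> connectedin (Euclidean_space n) S \<and> semialgebraic n S"
proof -
  let ?N = real_field
  have N: "expansion_of ?N real_field" by (simp add: expansion_of_def)
  have oN: "o_minimal ?N" using M by (rule o_minimal_reduct)
  define A where "A z \<longleftrightarrow> trunc_point n z \<in> T \<and> (\<exists>i<n. z i \<noteq> x i) \<and>
      (\<forall>i<n. z i < x i + z n \<and> x i < z i + z n)" for z
  define B where "B z \<longleftrightarrow> A z \<and> trunc_point n z \<in> X" for z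
  have A: "definable_pred ?N A"
    unfolding A_def using T(3)
    by (intro definable_intros N definable_pred_if_definable) (simp add: semialgebraic_def)
  have B: "definable_pred M B"
    unfolding B_def
    by (intro definable_pred_conj definable_pred_if_definable X definable_pred_expansion[OF M(1)] A)
  define r where "r k = inverse (real (Suc k))" for k
  have r: "filterlim r (at_right 0) sequentially"
    unfolding filterlim_at r_def[abs_def]
    using LIMSEQ_inverse_real_of_nat by (auto simp: eventually_sequentially)
  have "extends {n} A (\<lambda>_. r k)" for k
  proof -
    obtain y where y: "y \<in> T" "\<exists>i<n. y i \<noteq> x i" "\<forall>i<n. y i < x i + r k \<and> x i < y i + r k"
      using connected_infinite_nearby_point[OF T(2,1) xT, of "r k"] by (auto simp: r_def)
    have "y \<in> topspace (Euclidean_space n)"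
      using y(1) T(2) by (auto simp: connectedin_Euclidean_space)
    then have "trunc_point n (y(n := r k)) = y"
      by (auto simp: trunc_point_def topspace_Euclidean_space)
    then show ?thesis
      unfolding extends_def using y by (intro exI[of _ "y(n := r k)"]) (auto simp: A_def)
  qed
  moreover have "dense_over {n} A B (\<lambda>_. r k)" for k
    unfolding A_def[abs_def] B_def[abs_def] using dense_over_near_point[OF cl] .
  moreover have "x i - z n \<le> z i \<and> z i \<le> x i + z n" if "A z" "i < n" for z i
    using that by (auto simp: A_def algebra_simps less_imp_le)
  moreover have "A z" if "B z" for z using that by (simp add: B_def)
  ultimately obtain \<gamma> where \<gamma>: "definable_pred ?N (\<lambda>y. \<forall>i<n. y i = \<gamma> i (y n))"
    "\<And>k. extends {..n} B (curve_point n \<gamma> (r k))"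
    using definable_generic_curve[OF N oN M A B, where n = n and c = x and r = r] by blast
  define G where "G \<rho> \<longleftrightarrow> B (curve_point n \<gamma> \<rho>)" for \<rho>
  have B_cong: "B z = B z'" if "\<And>i. i \<le> n \<Longrightarrow> z i = z' i" for z z'
  proof -
    have "trunc_point n z = trunc_point n z'" using that by (auto simp: trunc_point_def)
    then show ?thesis using that by (auto simp: A_def B_def)
  qed
  have Gr: "G (r k)" for k
    using \<gamma>(2)[of k] B_cong unfolding G_def extends_def by (metis atMost_iff)
  (* G in first-order form: the coordinates of the curve are quantified away. *)
  have "extends {n} (\<lambda>z. (\<forall>i<n. z i = \<gamma> i (z n)) \<and> B z) ((\<lambda>_. 0)(n := \<rho>)) = G \<rho>" (is "?E = _") for \<rho>
  proof
    assume ?E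
    then obtain z where z: "z n = \<rho>" "\<forall>i<n. z i = \<gamma> i \<rho>" "B z" by (auto simp: extends_def)
    then have "B z = B (curve_point n \<gamma> \<rho>)" by (intro B_cong) (auto simp: curve_point_def)
    then show "G \<rho>" using z by (simp add: G_def)
  next
    assume "G \<rho>"
    then show ?E
      unfolding extends_def G_def by (intro exI[of _ "curve_point n \<gamma> \<rho>"]) (simp add: curve_point_def)
  qed
  moreover have "definable_pred M (extends {n} (\<lambda>z. (\<forall>i<n. z i = \<gamma> i (z n)) \<and> B z))"
    by (intro definable_pred_extends definable_pred_conj B definable_pred_expansion[OF M(1) \<gamma>(1)])
  from o_minimal_right_germ[OF M(2) this, of "\<lambda>_. 0" n 0]
  have "eventually (\<lambda>\<rho>. extends {n} (\<lambda>z. (\<forall>i<n. z i = \<gamma> i (z n)) \<and> B z) ((\<lambda>_. 0)(n := \<rho>))) (at_right 0) \<or>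
    eventually (\<lambda>\<rho>. \<not> extends {n} (\<lambda>z. (\<forall>i<n. z i = \<gamma> i (z n)) \<and> B z) ((\<lambda>_. 0)(n := \<rho>))) (at_right 0)" .
  ultimately have "eventually G (at_right 0) \<or> eventually (\<lambda>\<rho>. \<not> G \<rho>) (at_right 0)" by simp
  moreover have "\<not> eventually (\<lambda>\<rho>. \<not> G \<rho>) (at_right 0)"
    using eventually_compose_filterlim[OF _ r, of "\<lambda>\<rho>. \<not> G \<rho>"] Gr by auto
  ultimately have evG: "eventually G (at_right 0)" by blast
  have "eventually (\<lambda>\<rho>. isCont (\<gamma> i) \<rho>) (at_right 0)" if "i < n" for i
  proof (rule o_minimal_eventually_isCont[OF N oN])
    have "extends {i, n} (\<lambda>z. \<forall>i<n. z i = \<gamma> i (z n)) y \<longleftrightarrow> y i = \<gamma> i (y n)" for y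
    proof
      assume "y i = \<gamma> i (y n)"
      then show "extends {i, n} (\<lambda>z. \<forall>i<n. z i = \<gamma> i (z n)) y"
        unfolding extends_def using that
        by (intro exI[of _ "curve_point n \<gamma> (y n)"]) (auto simp: curve_point_def)
    qed (use that in \<open>auto simp: extends_def\<close>)
    then have "definable_pred ?N (\<lambda>y. y i = \<gamma> i (y n))"
      using definable_pred_extends[OF \<gamma>(1), of "{i, n}"] by (simp add: extends_def[abs_def])
    from definable_pred_subst[OF this, of "\<lambda>y k. if k = n then y 0 else y 1"]
    show "definable_pred ?N (\<lambda>y. y 1 = \<gamma> i (y 0))"
      using that by (simp add: definable_intros)
  qed
  then have "eventually (\<lambda>\<rho>. \<forall>i\<in>{..<n}. isCont (\<gamma> i) \<rho>) (at_right 0)"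
    by (intro eventually_ball_finite) auto
  with evG have "eventually (\<lambda>\<rho>. G \<rho> \<and> (\<forall>i\<in>{..<n}. isCont (\<gamma> i) \<rho>)) (at_right 0)"
    by (rule eventually_conj)
  then obtain \<epsilon> where \<epsilon>: "\<epsilon> > 0" "\<And>\<rho>. 0 < \<rho> \<Longrightarrow> \<rho> < \<epsilon> \<Longrightarrow> G \<rho>"
    "\<And>i \<rho>. i < n \<Longrightarrow> 0 < \<rho> \<Longrightarrow> \<rho> < \<epsilon> \<Longrightarrow> isCont (\<gamma> i) \<rho>"
    by (auto simp: eventually_at_right_field)
  have G: "trunc_point n (curve_point n \<gamma> \<rho>) \<in> X" "\<exists>i<n. \<gamma> i \<rho> \<noteq> x i"
    "\<And>i. i < n \<Longrightarrow> \<bar>\<gamma> i \<rho> - x i\<bar> < \<rho>" if "0 < \<rho>" "\<rho> < \<epsilon>" for \<rho>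
    using \<epsilon>(2)[OF that] by (auto simp: G_def B_def A_def curve_point_def abs_less_iff algebra_simps)
  have "x \<in> topspace (Euclidean_space n)"
    using T(2) xT by (auto simp: connectedin_Euclidean_space)
  from semialgebraic_arc[OF this \<epsilon>(1) \<gamma>(1) \<epsilon>(3) G(3) G(2)]
  show ?thesis
    using G(1) xX
    by (intro exI[of _ "insert x ((\<lambda>\<rho>. trunc_point n (curve_point n \<gamma> \<rho>)) ` {0<..<\<epsilon>})"]) auto
qed

theorem proposition1p2:
  fixes M :: real_structure and n :: nat and X :: "(nat \<Rightarrow> real) set"
  assumes "expansion_of M real_field" and "o_minimal M"
    and "X \<subseteq> topspace (Euclidean_space n)" and "definable M n X"
  shows "algebraic_part n X = algebraic_trace_part n X"
proof (intro equalityI subsetI)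
  fix x assume "x \<in> algebraic_part n X"
  then obtain S where S: "x \<in> S" "S \<subseteq> X" "infinite S" "connectedin (Euclidean_space n) S"
    "semialgebraic n S" by (auto simp: algebraic_part_def)
  have XS: "X \<inter> S = S" using S(2) by (rule Int_absorb1)
  have "S \<subseteq> Euclidean_space n closure_of (X \<inter> S)"
    unfolding XS using S(4) by (intro closure_of_subset) (simp only: connectedin_Euclidean_space)
  with S(3-5) have "X \<inter> S \<in> {X \<inter> T | T. infinite T \<and> connectedin (Euclidean_space n) T \<and>
      semialgebraic n T \<and> T \<subseteq> Euclidean_space n closure_of (X \<inter> T)}" by blast
  then show "x \<in> algebraic_trace_part n X"
    unfolding algebraic_trace_part_def by (rule UnionI) (simp only: XS S(1))
next
  fix x assume "x \<in> algebraic_trace_part n X"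
  then obtain T where T: "x \<in> X" "x \<in> T" "infinite T" "connectedin (Euclidean_space n) T"
    "semialgebraic n T" "T \<subseteq> Euclidean_space n closure_of (X \<inter> T)"
    by (auto simp: algebraic_trace_part_def)
  obtain S where "S \<subseteq> X" "x \<in> S" "infinite S" "connectedin (Euclidean_space n) S"
    "semialgebraic n S"
    using arc_through_trace_point[OF assms(1,2,4) T(1,3-6,2)] by (elim exE conjE)
  then show "x \<in> algebraic_part n X"
    unfolding algebraic_part_def by (intro UnionI[of S]) simp_all
qed

end
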